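(* Let $0<T<S<1$ be real numbers, and let $t$ be any complex number. Then $$\int_T^S\frac{F\left(\begin{matrix}2it,-2it\\ \frac12\end{matrix};\frac{(1+\sqrt z)(\sqrt z-\sqrt T)}{2(1-\sqrt T)\sqrt z}\right)F\left(\begin{matrix}it,-it\\ \frac12\end{matrix};-\frac{(S-z)(1-z)}{(1-\sqrt S)^2z}\right)}{(1-z)\sqrt{z-T}\sqrt{S-z}}\,dz=\frac{\pi}{\sqrt{1-T}\sqrt{1-S}}.$$
   Context: $F\left(\begin{matrix}\alpha,\beta\\ \gamma\end{matrix};z\right)$ denotes the Gauss hypergeometric function ${}_2F_1(\alpha,\beta;\gamma;z)$, given by $\sum_{k\ge 0}\frac{(\alpha)_k(\beta)_k}{(\gamma)_k k!}z^k$ for $|z|<1$ and by analytic continuation to $\mathbb{C}\setminus[1,\infty)$ otherwise. Here $i$ is the imaginary unit. *)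

theory Defs
  imports "HOL-Complex_Analysis.Complex_Analysis"
begin

definition slit_plane :: "complex set" where
  "slit_plane = - (complex_of_real ` {1..})"

text \<open>The value is meaningful only if \<open>c\<close> is not a non-positive integer.\<close>

definition hyp2f1_series :: "complex \<Rightarrow> complex \<Rightarrow> complex \<Rightarrow> complex \<Rightarrow> complex" where
  "hyp2f1_series a b c z =
     (\<Sum>k. pochhammer a k * pochhammer b k / (pochhammer c k * fact k) * z ^ k)"

definition is_hyp2f1_continuation ::
    "complex \<Rightarrow> complex \<Rightarrow> complex \<Rightarrow> (complex \<Rightarrow> complex) \<Rightarrow> bool" where
  "is_hyp2f1_continuation a b c f \<longleftrightarrow>
     f holomorphic_on slit_plane \<and> (\<forall>z. norm z < 1 \<longrightarrow> f z = hyp2f1_series a b c z)"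

text \<open>On the slit plane the choice is unique (see \<open>hyp2f1_unique\<close> below); values on the
  cut \<open>[1,\<infinity>)\<close> are left unspecified.\<close>

definition hyp2f1 :: "complex \<Rightarrow> complex \<Rightarrow> complex \<Rightarrow> complex \<Rightarrow> complex" where
  "hyp2f1 a b c = (SOME f. is_hyp2f1_continuation a b c f)"

lemma slit_plane_iff: "z \<in> slit_plane \<longleftrightarrow> \<not> (Im z = 0 \<and> Re z \<ge> 1)"
  by (auto simp: slit_plane_def image_iff complex_eq_iff)

lemma open_slit_plane: "open slit_plane"
proof -
  have "complex_of_real ` {1..} = {z. Im z = 0} \<inter> {z. Re z \<ge> 1}"
    by (auto simp: image_iff complex_eq_iff)
  moreover have "closed ({z. Im z = 0} \<inter> {z. Re z \<ge> 1})"
    by (intro closed_Int closed_Collect_eq closed_Collect_le continuous_intros)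
  ultimately show ?thesis
    unfolding slit_plane_def by (simp only: open_Compl)
qed

lemma connected_slit_plane: "connected slit_plane"
proof (rule starlike_imp_connected)
  show "starlike slit_plane"
    unfolding starlike_def
  proof (intro bexI[of _ 0] ballI subsetI)
    fix z w assume z: "z \<in> slit_plane" and "w \<in> closed_segment 0 z"
    then obtain u where u: "0 \<le> u" "u \<le> 1" "w = of_real u * z"
      by (auto simp: in_segment scaleR_conv_of_real)
    have "u * Re z \<le> Re z" if "0 \<le> Re z"
      using u that mult_left_le_one_le by blast
    moreover have "u * Re z \<le> 0" if "Re z < 0"
      using u that by (simp add: mult_nonneg_nonpos)
    ultimately show "w \<in> slit_plane"
      using z u by (cases "u = 0"; cases "Re z < 0") (auto simp: slit_plane_iff)
  qed (simp add: slit_plane_iff)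
qed

lemma hyp2f1_unique:
  assumes "is_hyp2f1_continuation a b c f" and "z \<in> slit_plane"
  shows "hyp2f1 a b c z = f z"
proof -
  have *: "is_hyp2f1_continuation a b c (hyp2f1 a b c)"
    unfolding hyp2f1_def by (rule someI[of "is_hyp2f1_continuation a b c", OF assms(1)])
  have sub: "ball 0 1 \<subseteq> slit_plane"
  proof
    fix w :: complex assume "w \<in> ball 0 1"
    then show "w \<in> slit_plane"
      using complex_Re_le_cmod[of w] by (auto simp: slit_plane_iff)
  qed
  show ?thesis
    by (rule analytic_continuation_open[where s = "ball 0 1" and s' = slit_plane])
      (use * assms sub in
        \<open>auto simp: open_slit_plane connected_slit_plane is_hyp2f1_continuation_def\<close>)
qed

end

theory Submission
  imports Defs "HOL-Real_Asymp.Real_Asymp"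
begin

text \<open>
  Since \<open>F(c, -c; 1/2; sin\<^sup>2 w) = cos (2 c w)\<close>, the two factors of the integrand are
  \<open>cos (2 i t \<alpha>)\<close> and \<open>cos (2 i t (i \<phi>))\<close> with
  \<open>cos \<alpha> = (a - z) / ((1 - a) \<surd>z)\<close>, \<open>cosh \<phi> = (b - z) / ((1 - b) \<surd>z)\<close>, \<open>a = \<surd>T\<close>, \<open>b = \<surd>S\<close>.
  Hence their product is the average of \<open>F(2it, -2it; 1/2; sin\<^sup>2 ((\<alpha> \<mp> i \<phi>) / 2))\<close>.
  Map the exterior of the slit \<open>[T, S]\<close> in the Riemann sphere conformally to the unit disc, with
  the point 1 going to 0. The measure \<open>dz / ((1 - z) \<surd>(z - T) \<surd>(S - z))\<close> is then a constant
  multiple of the arc length \<open>d\<theta>\<close> on the circle, and \<open>sin\<^sup>2 ((\<alpha> - i \<phi>) / 2)\<close> becomes the boundary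
  value of a rational function that maps the closed disc into the slit plane and vanishes at 0.
  By the mean value property the integral only depends on the value \<open>F(2it, -2it; 1/2; 0) = 1\<close>.
\<close>

subsection \<open>The hypergeometric function with parameters c, -c and 1/2\<close>

text \<open>As a formal power series, the Gauss series can be differentiated termwise and compared
  coefficient by coefficient with its differential equation.\<close>

definition hyp2f1_fps :: "complex \<Rightarrow> complex fps" where
  "hyp2f1_fps c = Abs_fps (\<lambda>k. pochhammer c k * pochhammer (- c) k / (pochhammer (1/2) k * fact k))"

lemma eval_hyp2f1_fps: "eval_fps (hyp2f1_fps c) z = hyp2f1_series c (- c) (1/2) z"
  by (simp add: eval_fps_def hyp2f1_fps_def hyp2f1_series_def)

lemma of_nat_plus_half_nonzero: "of_nat n + 1/2 \<noteq> (0::complex)"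
proof
  assume "of_nat n + 1/2 = (0::complex)"
  then have "Re (of_nat n + 1/2) = 0" by simp
  then show False by simp
qed

text \<open>The new Pochhammer factors \<open>c + n\<close> and \<open>- c + n\<close> multiply to
  \<open>n^2 - c^2\<close>. The denominators are cleared because this is the form in which the
  differential equation produces the recurrence.\<close>

lemma hyp2f1_fps_nth_Suc:
  "fps_nth (hyp2f1_fps c) (Suc n) * ((of_nat n + 1/2) * (of_nat n + 1)) =
   fps_nth (hyp2f1_fps c) n * ((of_nat n)\<^sup>2 - c\<^sup>2)"
proof -
  have "pochhammer (1/2 :: complex) k \<noteq> 0" for k
  proof (induction k)
    case (Suc k)
    then show ?case
      using of_nat_plus_half_nonzero[of k] by (simp add: pochhammer_Suc add.commute)
  qed simp
  moreover have "of_nat n + 1 \<noteq> (0::complex)"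
    using of_nat_neq_0[of n] by (simp add: add.commute)
  ultimately show ?thesis
    using of_nat_plus_half_nonzero[of n]
    by (simp add: hyp2f1_fps_def pochhammer_Suc divide_simps fact_Suc power2_eq_square)
       (auto simp: algebra_simps)
qed

lemma hyp2f1_fps_nth_Suc_norm:
  "norm (fps_nth (hyp2f1_fps c) (Suc n)) \<le>
   norm (fps_nth (hyp2f1_fps c) n) * (((real n)\<^sup>2 + norm c ^ 2) / ((real n + 1/2) * (real n + 1)))"
proof -
  have pos: "(real n + 1/2) * (real n + 1) > 0" by (simp add: add_nonneg_pos)
  have nh: "norm (of_nat n + 1/2 :: complex) = real n + 1/2"
  proof -
    have "of_nat n + 1/2 = complex_of_real (real n + 1/2)" by simp
    then show ?thesis by (simp only: norm_of_real)
  qed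
  have n1: "norm (of_nat n + 1 :: complex) = real n + 1"
    by (metis norm_of_nat of_nat_1 of_nat_add)
  have "norm (fps_nth (hyp2f1_fps c) (Suc n)) * ((real n + 1/2) * (real n + 1)) =
        norm (fps_nth (hyp2f1_fps c) n) * norm ((of_nat n)\<^sup>2 - c\<^sup>2)"
    using arg_cong[OF hyp2f1_fps_nth_Suc[of c n], of norm] by (simp only: norm_mult nh n1)
  also have "\<dots> \<le> norm (fps_nth (hyp2f1_fps c) n) * ((real n)\<^sup>2 + norm c ^ 2)"
    by (intro mult_left_mono order.trans[OF norm_triangle_ineq4]) (auto simp: norm_power)
  finally show ?thesis
    using pos by (simp add: pos_le_divide_eq)
qed

text \<open>Ratio test: the bound on the coefficient ratio tends to 1, so for \<open>r < 1\<close>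
  the ratio of consecutive terms eventually stays below \<open>(1 + r) / 2 < 1\<close>.\<close>

lemma fps_conv_radius_hyp2f1_fps: "fps_conv_radius (hyp2f1_fps c) \<ge> 1"
  unfolding fps_conv_radius_def
proof (rule conv_radius_geI_ex')
  fix r :: real assume r: "0 < r" "ereal r < 1"
  define A where "A = norm c ^ 2"
  have "(\<lambda>n. ((real n)\<^sup>2 + A) / ((real n + 1/2) * (real n + 1)) * r) \<longlonglongrightarrow> r"
    by real_asymp
  moreover have "r < (1 + r) / 2" using r by (simp add: one_ereal_def)
  ultimately have "\<forall>\<^sub>F n in sequentially.
      ((real n)\<^sup>2 + A) / ((real n + 1/2) * (real n + 1)) * r < (1 + r) / 2"
    by (rule order_tendstoD)
  then obtain N where N: "\<And>n. n \<ge> N \<Longrightarrow>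
      ((real n)\<^sup>2 + A) / ((real n + 1/2) * (real n + 1)) * r < (1 + r) / 2"
    by (auto simp: eventually_sequentially)
  show "summable (\<lambda>n. fps_nth (hyp2f1_fps c) n * of_real r ^ n)"
  proof (rule summable_ratio_test)
    show "(1 + r) / 2 < 1" using r by (simp add: one_ereal_def)
    fix n assume n: "n \<ge> N"
    have "norm (fps_nth (hyp2f1_fps c) (Suc n) * of_real r ^ Suc n) =
          norm (fps_nth (hyp2f1_fps c) (Suc n)) * r ^ Suc n"
      using r by (simp add: norm_mult norm_power)
    also have "\<dots> \<le> norm (fps_nth (hyp2f1_fps c) n) *
        (((real n)\<^sup>2 + A) / ((real n + 1/2) * (real n + 1))) * r ^ Suc n"
      using hyp2f1_fps_nth_Suc_norm[of c n] r unfolding A_def by (intro mult_right_mono) auto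
    also have "\<dots> = (((real n)\<^sup>2 + A) / ((real n + 1/2) * (real n + 1)) * r) *
        (norm (fps_nth (hyp2f1_fps c) n) * r ^ n)"
      by simp
    also have "\<dots> \<le> (1 + r) / 2 * (norm (fps_nth (hyp2f1_fps c) n) * r ^ n)"
      using N[OF n] r by (intro mult_right_mono) auto
    finally show "norm (fps_nth (hyp2f1_fps c) (Suc n) * of_real r ^ Suc n)
        \<le> (1 + r) / 2 * norm (fps_nth (hyp2f1_fps c) n * of_real r ^ n)"
      using r by (simp add: norm_mult norm_power)
  qed
qed

section \<open>The hypergeometric differential equation inside the unit disc\<close>

lemma less_fps_conv_radius_mult:
  assumes "norm z < fps_conv_radius f" "norm z < fps_conv_radius g"
  shows "norm z < fps_conv_radius (f * g)"
proof -
  have "norm z < min (fps_conv_radius f) (fps_conv_radius g)" using assms by simp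
  also note fps_conv_radius_mult
  finally show ?thesis .
qed

lemma less_fps_conv_radius_add:
  assumes "norm z < fps_conv_radius f" "norm z < fps_conv_radius g"
  shows "norm z < fps_conv_radius (f + g)"
proof -
  have "norm z < min (fps_conv_radius f) (fps_conv_radius g)" using assms by simp
  also note fps_conv_radius_add
  finally show ?thesis .
qed

lemma less_fps_conv_radius_diff:
  assumes "norm z < fps_conv_radius f" "norm z < fps_conv_radius g"
  shows "norm z < fps_conv_radius (f - g)"
proof -
  have "norm z < min (fps_conv_radius f) (fps_conv_radius g)" using assms by simp
  also note fps_conv_radius_diff
  finally show ?thesis .
qed

lemma less_fps_conv_radius_deriv:
  fixes f :: "complex fps"
  assumes "norm z < fps_conv_radius f"
  shows "norm z < fps_conv_radius (fps_deriv f)"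
  using fps_conv_radius_deriv[of f] assms less_le_trans by blast

lemma less_fps_conv_radius_hyp2f1:
  assumes "norm z < 1"
  shows "norm z < fps_conv_radius (hyp2f1_fps c)"
proof -
  have "ereal (norm z) < 1" using assms by (simp add: one_ereal_def)
  then show ?thesis using fps_conv_radius_hyp2f1_fps less_le_trans by blast
qed

text \<open>Gauss's equation \<open>z (1 - z) Y'' + (1/2 - z) Y' + c^2 Y = 0\<close>, multiplied by
  4. The n-th coefficient of the left side is 4 times the difference of the two sides of the
  coefficient recurrence, hence 0.\<close>

lemma hyp2f1_series_ode:
  fixes c z :: complex
  defines "Y \<equiv> hyp2f1_fps c"
  assumes z: "norm z < 1"
  shows "4 * (z * (1 - z)) * eval_fps (fps_deriv (fps_deriv Y)) z
       + (2 - 4 * z) * eval_fps (fps_deriv Y) z + 4 * c\<^sup>2 * eval_fps Y z = 0"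
proof -
  define R where "R = (fps_const 4 * (fps_X * fps_deriv (fps_deriv Y))
       - fps_const 4 * (fps_X * (fps_X * fps_deriv (fps_deriv Y))))
       + (fps_const 2 * fps_deriv Y - fps_const 4 * (fps_X * fps_deriv Y)) + fps_const (4 * c\<^sup>2) * Y"
  have "fps_nth R n = 0" for n
  proof -
    have "fps_nth R n = 4 * (fps_nth Y (Suc n) * ((of_nat n + 1/2) * (of_nat n + 1))
        - fps_nth Y n * ((of_nat n)\<^sup>2 - c\<^sup>2))"
    \<comment> \<open>Multiplication by \<open>fps_X\<close> once and twice shifts the coefficients
      by one and two places, so the indices 0 and 1 are separate cases.\<close>
    proof (cases n)
      case (Suc m)
      then show ?thesis
        by (cases m) (simp_all add: R_def algebra_simps power2_eq_square)
    qed (simp add: R_def)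
    then show ?thesis
      using hyp2f1_fps_nth_Suc[of c n] by (simp add: Y_def)
  qed
  then have "eval_fps R z = 0" by (simp add: eval_fps_def)
  moreover have "norm z < fps_conv_radius Y"
    unfolding Y_def by (rule less_fps_conv_radius_hyp2f1[OF z])
  ultimately show ?thesis
    unfolding R_def
    by (simp add: eval_fps_add eval_fps_diff eval_fps_mult less_fps_conv_radius_mult
        less_fps_conv_radius_add less_fps_conv_radius_diff less_fps_conv_radius_deriv)
       (simp add: algebra_simps)
qed

section \<open>Holomorphy of the closed form on the slit plane\<close>

text \<open>Negating \<open>z\<close> replaces the argument \<open>u\<close> of the logarithm by its
  reciprocal, because \<open>(csqrt (1 - z^2) + i z) (csqrt (1 - z^2) - i z) = 1\<close>. The
  hypothesis on real \<open>z\<close> keeps \<open>u\<close> off the cut of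
  \<open>Ln\<close>.\<close>

lemma Arcsin_minus:
  assumes "Im z = 0 \<Longrightarrow> \<bar>Re z\<bar> < 1"
  shows "Arcsin (- z) = - Arcsin z"
proof -
  define u where "u = \<i> * z + csqrt (1 - z\<^sup>2)"
  have "u \<notin> \<real>\<^sub>\<le>\<^sub>0"
    unfolding u_def by (metis isCont_Arcsin_lemma assms complex_nonpos_Reals_iff)
  then have "Ln (inverse u) = - Ln u"
    by (rule Ln_inverse)
  moreover have "inverse u = \<i> * (- z) + csqrt (1 - (- z)\<^sup>2)"
  proof (rule inverse_unique)
    show "u * (\<i> * (- z) + csqrt (1 - (- z)\<^sup>2)) = 1"
      using power2_csqrt[of "1 - z\<^sup>2"] by (simp add: u_def algebra_simps power2_eq_square)
  qed
  ultimately show ?thesis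
    by (simp add: Arcsin_def u_def)
qed

text \<open>The point 0 is the end of the cut of \<open>csqrt\<close>; continuity survives there
  since \<open>norm (csqrt x) = sqrt (norm x)\<close>.\<close>

lemma isCont_csqrt_0: "isCont csqrt 0"
proof -
  have "((\<lambda>x. sqrt (cmod x)) \<longlongrightarrow> sqrt (cmod 0)) (at 0)"
    by (intro tendsto_intros)
  then have "(csqrt \<longlongrightarrow> 0) (at 0)"
    by (intro tendsto_norm_zero_cancel[of csqrt]) simp
  then show ?thesis
    by (simp add: isCont_def)
qed

text \<open>A real square root of modulus at least 1 would have its square on the cut. This is the
  side condition for holomorphy of \<open>Arcsin\<close> at \<open>csqrt z\<close>.\<close>

lemma csqrt_slit_plane:
  assumes "z \<in> slit_plane" "Im (csqrt z) = 0"
  shows "\<bar>Re (csqrt z)\<bar> < 1"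
proof (rule ccontr)
  assume *: "\<not> ?thesis"
  have "z = csqrt z ^ 2" by simp
  then have "Im z = 0" "Re z = Re (csqrt z) ^ 2"
    using assms(2) by (metis Im_power2 mult_zero_right, metis Re_power2 assms(2) diff_zero power_zero_numeral)
  moreover have "1 \<le> Re (csqrt z) ^ 2"
    using * abs_square_less_1[of "Re (csqrt z)"] by linarith
  ultimately show False
    using assms(1) by (simp only: slit_plane_iff) auto
qed

text \<open>\<open>csqrt\<close> jumps across the negative axis, but the function is even in the square root, so there
  the branch \<open>\<i> * csqrt (- x)\<close> can be used instead; 0 is a removable singularity.\<close>

lemma holomorphic_on_cos_Arcsin_csqrt:
  "(\<lambda>x. cos (2 * c * Arcsin (csqrt x))) holomorphic_on slit_plane"
proof (rule no_isolated_singularity)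
  let ?f = "\<lambda>x. cos (2 * c * Arcsin (csqrt x))"
  have A: "?f holomorphic_on slit_plane - \<real>\<^sub>\<le>\<^sub>0"
  proof -
    have "(Arcsin \<circ> csqrt) holomorphic_on slit_plane - \<real>\<^sub>\<le>\<^sub>0"
      by (intro holomorphic_on_compose holomorphic_on_Arcsin holomorphic_intros)
         (use csqrt_slit_plane in auto)
    then show ?thesis
      by (intro holomorphic_intros) (simp add: o_def)
  qed
  have ev: "?f x = cos (2 * c * Arcsin (\<i> * csqrt (- x)))" if "x \<in> slit_plane" for x
  proof -
    have "(csqrt x)\<^sup>2 = (\<i> * csqrt (- x))\<^sup>2"
      by (simp add: power_mult_distrib)
    then consider "\<i> * csqrt (- x) = csqrt x" | "\<i> * csqrt (- x) = - csqrt x"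
      by (metis power2_eq_iff)
    then show ?thesis
    proof cases
      case 2
      then show ?thesis
        using Arcsin_minus[of "csqrt x"] csqrt_slit_plane[OF that] by auto
    qed auto
  qed
  let ?V = "{x::complex. - x \<notin> \<real>\<^sub>\<le>\<^sub>0}"
  have B: "?f holomorphic_on ?V"
  proof -
    have "(Arcsin \<circ> (\<lambda>x. \<i> * csqrt (- x))) holomorphic_on ?V"
    proof (intro holomorphic_on_compose holomorphic_on_Arcsin holomorphic_intros)
      \<comment> \<open>A real value of \<open>\<i> * csqrt (- x)\<close> forces
        \<open>csqrt (- x)\<close> to be imaginary, so \<open>- x\<close> is a nonpositive real,
        which \<open>?V\<close> excludes: the condition on real arguments of \<open>Arcsin\<close>
        is vacuous here.\<close>
      fix z assume z: "z \<in> (\<lambda>x. \<i> * csqrt (- x)) ` ?V" "Im z = 0"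
      then obtain x where x: "- x \<notin> \<real>\<^sub>\<le>\<^sub>0" "z = \<i> * csqrt (- x)" by auto
      with z(2) have "Re (csqrt (- x)) = 0" by simp
      moreover have "- x = csqrt (- x) ^ 2" by simp
      ultimately have "Im (- x) = 0" "Re (- x) \<le> 0"
        by (metis Im_power2 mult_zero_left mult_zero_right, metis Re_power2 \<open>- x = csqrt (- x) ^ 2\<close> \<open>Re (csqrt (- x)) = 0\<close> diff_0 neg_le_0_iff_le power_zero_numeral zero_le_power2)
      then have "- x \<in> \<real>\<^sub>\<le>\<^sub>0"
        by (simp add: complex_nonpos_Reals_iff)
      with x show "\<bar>Re z\<bar> < 1" by simp
    qed auto
    then have "(\<lambda>x. cos (2 * c * Arcsin (\<i> * csqrt (- x)))) holomorphic_on ?V"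
      by (intro holomorphic_intros) (simp add: o_def)
    moreover have "cos (2 * c * Arcsin (\<i> * csqrt (- x))) = ?f x" if "x \<in> ?V" for x
      by (rule ev[symmetric]) (use that in \<open>auto simp: slit_plane_iff complex_nonpos_Reals_iff\<close>)
    ultimately show ?thesis
      by (rule holomorphic_transform) simp
  qed
  \<comment> \<open>The two branches live on the complements of the nonpositive and of the
    nonnegative reals; within the slit plane these miss only 0 together with the positive reals
    below 1 or the negative reals, so jointly only 0.\<close>
  have sub: "slit_plane - {0} = (slit_plane - \<real>\<^sub>\<le>\<^sub>0) \<union> ?V"
    by (auto simp: slit_plane_iff complex_nonpos_Reals_iff complex_eq_iff)
  have "open ?V"
  proof -
    have "?V = - \<real>\<^sub>\<ge>\<^sub>0" by auto
    then show ?thesis by (simp add: open_Compl)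
  qed
  with A B show H: "?f holomorphic_on slit_plane - {0}"
    unfolding sub by (intro holomorphic_on_Un) (auto intro: open_Diff open_slit_plane)
  show "continuous_on slit_plane ?f"
  proof (rule continuous_at_imp_continuous_on, rule)
    fix x assume x: "x \<in> slit_plane"
    show "isCont ?f x"
    proof (cases "x = 0")
      case False
      then show ?thesis
        using holomorphic_on_imp_continuous_on[OF H] x
        by (simp add: continuous_on_eq_continuous_at open_Diff open_slit_plane)
    next
      case True
      have "isCont (\<lambda>x. Arcsin (csqrt x)) 0"
        by (rule isCont_Arcsin'[OF isCont_csqrt_0]) simp
      then show ?thesis unfolding True
        by (intro continuous_intros) auto
    qed
  qed
qed (auto simp: open_slit_plane)

section \<open>The series as a cosine, and its continuation\<close>

text \<open>Rotating the pair of \<open>g'\<close> and \<open>k * g\<close> through the angle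
  \<open>k * z\<close> gives the constants of motion \<open>u\<close> and \<open>v\<close>; rotating
  back recovers the solution. With the factor \<open>k\<close> kept on both sides no division
  occurs, and for \<open>k = 0\<close> the identity is trivial.\<close>

lemma harmonic_oscillator_unique:
  fixes g g' :: "complex \<Rightarrow> complex"
  assumes S: "convex S" "0 \<in> S" "z \<in> S"
    and g: "\<And>z. z \<in> S \<Longrightarrow> (g has_field_derivative g' z) (at z)"
    and g': "\<And>z. z \<in> S \<Longrightarrow> (g' has_field_derivative - (k\<^sup>2 * g z)) (at z)"
  shows "k * g z = k * g 0 * cos (k * z) + g' 0 * sin (k * z)"
proof -
  define u where "u = (\<lambda>z. g' z * cos (k * z) + k * g z * sin (k * z))"
  define v where "v = (\<lambda>z. k * g z * cos (k * z) - g' z * sin (k * z))"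
  have "(u has_field_derivative 0) (at x within S)" if "x \<in> S" for x
    unfolding u_def using that
    by (auto intro!: derivative_eq_intros DERIV_subset[OF g] DERIV_subset[OF g']
        simp: algebra_simps power2_eq_square)
  then have u: "u z = u 0"
    using S by (metis has_field_derivative_zero_constant)
  have "(v has_field_derivative 0) (at x within S)" if "x \<in> S" for x
    unfolding v_def using that
    by (auto intro!: derivative_eq_intros DERIV_subset[OF g] DERIV_subset[OF g']
        simp: algebra_simps power2_eq_square)
  then have v: "v z = v 0"
    using S by (metis has_field_derivative_zero_constant)
  have "v z * cos (k * z) + u z * sin (k * z) = k * g z * ((sin (k * z))\<^sup>2 + (cos (k * z))\<^sup>2)"
    unfolding u_def v_def by algebra
  then show ?thesis
    unfolding u v by (simp add: u_def v_def)
qed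

text \<open>The substitution of \<open>sin w ^ 2\<close> turns the hypergeometric equation into the
  oscillator equation with frequency \<open>2 * c\<close> and initial values 1 and 0. A small ball
  keeps \<open>sin w ^ 2\<close> inside the disc of convergence.\<close>

lemma hyp2f1_series_sin_squared:
  "\<exists>\<delta>>0. \<forall>w. norm w < \<delta> \<longrightarrow> norm (sin w ^ 2) < 1 \<and>
     hyp2f1_series c (- c) (1/2) (sin w ^ 2) = cos (2 * c * w)"
proof -
  define Y where "Y = hyp2f1_fps c"
  have "\<forall>\<^sub>F w in nhds (0::complex). norm (sin w ^ 2) < 1"
    by (intro order_tendstoD(2)[where y = "norm (sin (0::complex) ^ 2)"] tendsto_intros filterlim_ident) auto
  then obtain \<delta> where \<delta>: "\<delta> > 0" "\<And>w. w \<in> ball 0 \<delta> \<Longrightarrow> norm (sin w ^ 2 :: complex) < 1"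
    by (auto simp: eventually_nhds_metric dist_norm)
  have rY: "norm (sin w ^ 2) < fps_conv_radius Y" if "w \<in> ball 0 \<delta>" for w :: complex
    unfolding Y_def by (rule less_fps_conv_radius_hyp2f1[OF \<delta>(2)[OF that]])
  define g where "g = (\<lambda>w. eval_fps Y (sin w ^ 2))"
  define g' where "g' = (\<lambda>w. eval_fps (fps_deriv Y) (sin w ^ 2) * (2 * sin w * cos w))"
  have sq: "((\<lambda>w. sin w ^ 2) has_field_derivative 2 * sin w * cos w) (at w)" for w :: complex
    by (auto intro!: derivative_eq_intros)
  have g: "(g has_field_derivative g' w) (at w)" if "w \<in> ball 0 \<delta>" for w
    unfolding g_def g'_def
    by (rule DERIV_chain2[OF has_field_derivative_eval_fps sq]) (rule rY[OF that])
  have ch: "((\<lambda>w. eval_fps (fps_deriv Y) (sin w ^ 2)) has_field_derivative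
       eval_fps (fps_deriv (fps_deriv Y)) (sin w ^ 2) * (2 * sin w * cos w)) (at w)"
    if "w \<in> ball 0 \<delta>" for w
    by (rule DERIV_chain2[OF has_field_derivative_eval_fps sq])
       (rule less_fps_conv_radius_deriv[OF rY[OF that]])
  have g': "(g' has_field_derivative - ((2 * c)\<^sup>2 * g w)) (at w)" if "w \<in> ball 0 \<delta>" for w
  proof -
    define s where "s = sin w ^ 2"
    have c2: "cos w ^ 2 = 1 - s" by (simp add: s_def cos_squared_eq)
    define y where "y = eval_fps (fps_deriv (fps_deriv Y)) s"
    define y' where "y' = eval_fps (fps_deriv Y) s"
    have "(g' has_field_derivative
        y * (2 * sin w * cos w) * (2 * sin w * cos w) +
        (2 * (cos w * cos w) - 2 * (sin w * sin w)) * y') (at w)"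
      unfolding g'_def
      by (rule derivative_eq_intros ch[OF that] refl)+
         (simp add: y_def y'_def s_def algebra_simps)
    \<comment> \<open>The squared derivative of \<open>sin w ^ 2\<close> is
      \<open>4 * (s * (1 - s))\<close> and its second derivative is \<open>2 - 4 * s\<close>,
      exactly the coefficients of the differential equation.\<close>
    also have "y * (2 * sin w * cos w) * (2 * sin w * cos w) = 4 * (s * (1 - s)) * y"
      unfolding c2[symmetric] by (simp add: s_def power2_eq_square)
    also have "2 * (cos w * cos w) - 2 * (sin w * sin w) = 2 - 4 * s"
      using c2 by (simp add: s_def power2_eq_square)
    also have "4 * (s * (1 - s)) * y + (2 - 4 * s) * y' = - ((2 * c)\<^sup>2 * g w)"
      using hyp2f1_series_ode[OF \<delta>(2)[OF that], of c]
      by (simp add: y_def y'_def g_def Y_def s_def power_mult_distrib add_eq_0_iff2)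
    finally show ?thesis .
  qed
  have g0: "g 0 = 1"
    by (simp add: g_def eval_fps_at_0 Y_def hyp2f1_fps_def)
  have "g w = cos (2 * c * w)" if "w \<in> ball 0 \<delta>" for w
  \<comment> \<open>The oscillator lemma determines only \<open>2 * c * g w\<close>, so
    \<open>c = 0\<close> is treated directly: the series is then the constant 1.\<close>
  proof (cases "c = 0")
    case True
    have "fps_nth Y n = (if n = 0 then 1 else 0)" for n
      using True by (simp add: Y_def hyp2f1_fps_def pochhammer_0_left)
    then have "Y = 1" by (simp add: fps_eq_iff)
    then show ?thesis using True by (simp add: g_def)
  next
    case False
    then show ?thesis
      using harmonic_oscillator_unique[of "ball 0 \<delta>" w g g' "2 * c"] g g' that \<open>\<delta> > 0\<close>
      by (auto simp: g0 g'_def)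
  qed
  then show ?thesis
    using \<delta> unfolding g_def Y_def eval_hyp2f1_fps by (intro exI[of _ \<delta>]) auto
qed

text \<open>Near 0 the value \<open>Arcsin (csqrt x)\<close> is small and its squared sine is
  \<open>x\<close>, so the local formula applies; the identity theorem extends the equality to the
  whole unit disc.\<close>

lemma is_hyp2f1_continuation_cos_Arcsin:
  "is_hyp2f1_continuation c (- c) (1/2) (\<lambda>x. cos (2 * c * Arcsin (csqrt x)))"
  unfolding is_hyp2f1_continuation_def
proof (intro conjI allI impI holomorphic_on_cos_Arcsin_csqrt)
  fix z :: complex assume z: "norm z < 1"
  let ?f = "\<lambda>x. cos (2 * c * Arcsin (csqrt x))"
  obtain \<delta> where \<delta>: "\<delta> > 0"
    "\<And>w. norm w < \<delta> \<Longrightarrow> hyp2f1_series c (- c) (1/2) (sin w ^ 2) = cos (2 * c * w)"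
    using hyp2f1_series_sin_squared by blast
  have "isCont (\<lambda>x. norm (Arcsin (csqrt x))) 0"
    by (intro continuous_norm isCont_Arcsin' isCont_csqrt_0) simp
  then have "\<forall>\<^sub>F x in nhds 0. norm (Arcsin (csqrt x)) < \<delta>"
    by (intro order_tendstoD(2)[where y = "norm (Arcsin (csqrt 0))"])
       (use \<open>\<delta> > 0\<close> in \<open>auto simp: isCont_def tendsto_nhds_iff\<close>)
  then obtain e where e: "e > 0" "\<And>x. x \<in> ball 0 e \<Longrightarrow> norm (Arcsin (csqrt x)) < \<delta>"
    by (auto simp: eventually_nhds_metric dist_norm)
  have sub: "ball 0 1 \<subseteq> slit_plane"
  proof
    fix w :: complex assume "w \<in> ball 0 1"
    then show "w \<in> slit_plane"
      using complex_Re_le_cmod[of w] by (auto simp: slit_plane_iff)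
  qed
  show "?f z = hyp2f1_series c (- c) (1/2) z"
  proof (rule analytic_continuation_open[where s = "ball 0 (min 1 e)" and s' = "ball 0 1" and f = ?f])
    show "?f holomorphic_on ball 0 1"
      by (rule holomorphic_on_subset[OF holomorphic_on_cos_Arcsin_csqrt sub])
    show "hyp2f1_series c (- c) (1/2) holomorphic_on ball 0 1"
    proof -
      have "ball (0::complex) 1 \<subseteq> eball 0 (fps_conv_radius (hyp2f1_fps c))"
      proof
        fix w :: complex assume "w \<in> ball 0 1"
        then show "w \<in> eball 0 (fps_conv_radius (hyp2f1_fps c))"
          using less_fps_conv_radius_hyp2f1[of w c] by (simp add: eball_def)
      qed
      then have "eval_fps (hyp2f1_fps c) holomorphic_on ball 0 1"
        by (rule holomorphic_on_eval_fps)
      then show ?thesis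
        by (simp add: eval_hyp2f1_fps[abs_def] cong: holomorphic_cong)
    qed
    fix x :: complex assume x: "x \<in> ball 0 (min 1 e)"
    then have "norm (Arcsin (csqrt x)) < \<delta>" by (intro e) auto
    from \<delta>(2)[OF this] show "?f x = hyp2f1_series c (- c) (1/2) x" by simp
  qed (use e z in auto)
qed

lemma hyp2f1_holomorphic: "hyp2f1 c (- c) (1/2) holomorphic_on slit_plane"
  by (rule holomorphic_transform[OF holomorphic_on_cos_Arcsin_csqrt[of c]])
     (use hyp2f1_unique[OF is_hyp2f1_continuation_cos_Arcsin] in simp)

text \<open>A real value \<open>sin w ^ 2 \<ge> 1\<close> would make \<open>cos w ^ 2\<close> real
  and nonpositive, hence \<open>cos w\<close> imaginary; but in this strip its real part
  \<open>cos (Re w) * cosh (Im w)\<close> is positive.\<close>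

lemma sin_squared_in_slit_plane:
  assumes "\<bar>Re w\<bar> < pi/2"
  shows "sin w ^ 2 \<in> slit_plane"
proof (rule ccontr)
  assume "\<not> ?thesis"
  then have "Im (sin w ^ 2) = 0" "Re (sin w ^ 2) \<ge> 1" by (auto simp: slit_plane_iff)
  then have "Im (cos w ^ 2) = 0" "Re (cos w ^ 2) \<le> 0" by (auto simp: cos_squared_eq)
  then have "Re (cos w) = 0"
    by (auto simp: Re_power2 Im_power2)
  moreover have "cos (Re w) > 0" using assms by (intro cos_gt_zero_pi) auto
  moreover have "exp (Im w) + exp (- Im w) > 0" by (simp add: add_pos_pos)
  ultimately show False by (auto simp: Re_cos)
qed

text \<open>\<open>csqrt\<close> may return either \<open>sin w\<close> or \<open>sin (- w)\<close>;
  \<open>Arcsin\<close> then gives \<open>w\<close> or \<open>- w\<close>, and the cosine does not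
  see the sign.\<close>

lemma hyp2f1_sin_squared:
  assumes "\<bar>Re w\<bar> < pi/2"
  shows "hyp2f1 c (- c) (1/2) (sin w ^ 2) = cos (2 * c * w)"
proof -
  have "hyp2f1 c (- c) (1/2) (sin w ^ 2) = cos (2 * c * Arcsin (csqrt (sin w ^ 2)))"
    using hyp2f1_unique[OF is_hyp2f1_continuation_cos_Arcsin sin_squared_in_slit_plane[OF assms]] .
  moreover have "csqrt (sin w ^ 2) = sin w \<or> csqrt (sin w ^ 2) = sin (- w)"
    by (metis power2_csqrt power2_eq_iff sin_minus)
  moreover have "Arcsin (sin w) = w" "Arcsin (sin (- w)) = - w"
    using assms by (intro Arcsin_sin; simp)+
  ultimately show ?thesis by fastforce
qed

lemma hyp2f1_at_0: "hyp2f1 c (- c) (1/2) 0 = 1"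
  using hyp2f1_sin_squared[of 0 c] by simp

subsection \<open>Uniformization of the exterior of the slit\<close>

text \<open>Cauchy's formula at the centre, with the lower half circle folded onto the upper one,
  because each interior point of the slit corresponds to a conjugate pair on the circle.\<close>

lemma mean_value_circle_symmetric:
  fixes f :: "complex \<Rightarrow> complex"
  assumes "f holomorphic_on cball 0 1"
  shows "((\<lambda>x. f (cis x) + f (cnj (cis x))) has_integral 2 * of_real pi * f 0) {0..pi}"
proof -
  have cont: "continuous_on A (\<lambda>x. f (cis x))" for A
    by (rule continuous_on_compose2[OF holomorphic_on_imp_continuous_on[OF assms]])
       (auto intro!: continuous_intros)
  have "((\<lambda>u. f u / (u - 0)) has_contour_integral (2 * of_real pi * \<i> * f 0)) (circlepath 0 1)"
    by (rule Cauchy_integral_circlepath_simple[OF assms]) simp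
  then have "((\<lambda>x. f (exp (2 * of_real pi * \<i> * of_real x)) * (2 * of_real pi * \<i>))
      has_integral 2 * of_real pi * \<i> * f 0) {0..1}"
    unfolding has_contour_integral
    by (rule has_integral_eq[rotated])
       (simp add: vector_derivative_circlepath, simp add: circlepath divide_simps)
  then have "((\<lambda>x. f (exp (2 * of_real pi * \<i> * of_real x)) * (2 * of_real pi * \<i>) / \<i>)
      has_integral (2 * of_real pi * \<i> * f 0) / \<i>) {0..1}"
    by (rule has_integral_divide)
  then have "((\<lambda>x. f (cis (2 * pi * x)) * (2 * of_real pi)) has_integral (2 * of_real pi * f 0)) {0..1}"
    by (simp add: cis_conv_exp mult_ac)
  then have circ: "((\<lambda>x. (2 * pi) *\<^sub>R f (cis (2 * pi * x))) has_integral (2 * of_real pi * f 0)) {0..1}"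
    by (simp add: scaleR_conv_of_real mult.commute)
  have int: "(\<lambda>x. f (cis x)) integrable_on {a..b}" for a b
    by (intro integrable_continuous_interval cont)
  have "((\<lambda>x. (2 * pi) *\<^sub>R f (cis (2 * pi * x))) has_integral
       integral {2 * pi * 0..2 * pi * 1} (\<lambda>x. f (cis x))) {0..1}"
    by (rule has_integral_substitution[where c = 0 and d = "2 * pi" and g = "\<lambda>x. 2 * pi * x"])
       (auto intro!: cont derivative_eq_intros)
  from has_integral_unique[OF this circ]
  have full: "integral {0..2 * pi} (\<lambda>x. f (cis x)) = 2 * of_real pi * f 0"
    by simp
  have int': "((\<lambda>x. f (cis x)) has_integral integral {a..b} (\<lambda>x. f (cis x))) {a..b}" for a b
    using int by (rule integrable_integral)
  \<comment> \<open>Reflection followed by a shift through \<open>2 * pi\<close> carries the lower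
    half circle to \<open>{0..pi}\<close> and turns \<open>cis x\<close> into its conjugate.\<close>
  have "((\<lambda>x. f (cis (- x))) has_integral integral {pi..2 * pi} (\<lambda>x. f (cis x))) {- (2 * pi)..- pi}"
    by (rule has_integral_reflect_lemma_real[OF int'])
  from has_integral_shift_real_ivl[OF this, of "- (2 * pi)"]
  have "((\<lambda>x. f (cis (- x + 2 * pi))) has_integral integral {pi..2 * pi} (\<lambda>x. f (cis x))) {0..pi}"
    by simp
  moreover have "cis (- x + 2 * pi) = cnj (cis x)" for x
    by (simp add: complex_eq_iff)
  ultimately have "((\<lambda>x. f (cnj (cis x))) has_integral integral {pi..2 * pi} (\<lambda>x. f (cis x))) {0..pi}"
    by (simp only:)
  from has_integral_add[OF int'[of 0 pi] this]
  have "((\<lambda>x. f (cis x) + f (cnj (cis x))) has_integral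
      (integral {0..pi} (\<lambda>x. f (cis x)) + integral {pi..2 * pi} (\<lambda>x. f (cis x)))) {0..pi}" .
  also have "integral {0..pi} (\<lambda>x. f (cis x)) + integral {pi..2 * pi} (\<lambda>x. f (cis x)) = 2 * of_real pi * f 0"
    unfolding full[symmetric]
    by (rule Henstock_Kurzweil_Integration.integral_combine) (auto intro: int)
  finally show ?thesis .
qed

section \<open>A rational map from the closed disc into the slit plane\<close>

text \<open>A value on the cut forces \<open>z\<close> to be real and then negative. On
  \<open>[-1, 0)\<close> the quotient is at most \<open>M / ((A + B) * (E + F))\<close>, its value
  at -1, which is below 1 by hypothesis.\<close>

lemma quotient_in_slit_plane:
  fixes A B E F M :: real
  assumes B: "0 \<le> B" "B < A" and F: "0 \<le> F" "F < E" and M: "0 \<le> M" "M < (A + B) * (E + F)"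
    and z: "norm z \<le> 1"
  shows "(of_real A - of_real B * z) * (of_real E - of_real F * z) \<noteq> 0"
    and "- of_real M * z / ((of_real A - of_real B * z) * (of_real E - of_real F * z)) \<in> slit_plane"
proof -
  have ne: "of_real A - of_real B * z \<noteq> 0" if "0 \<le> B" "B < A" for A B :: real
  proof
    assume "of_real A - of_real B * z = 0"
    then have "norm (complex_of_real A) = norm (of_real B * z)" by simp
    then have "A = B * norm z" using that by (simp add: norm_mult)
    moreover have "B * norm z \<le> B" using that z by (simp add: mult_left_le)
    ultimately show False using that by simp
  qed
  define D where "D = (of_real A - of_real B * z) * (of_real E - of_real F * z)"
  show D0: "(of_real A - of_real B * z) * (of_real E - of_real F * z) \<noteq> 0"
    using ne[OF B] ne[OF F] by simp
  show "- of_real M * z / ((of_real A - of_real B * z) * (of_real E - of_real F * z)) \<in> slit_plane"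
  proof (rule ccontr)
    assume "\<not> ?thesis"
    then obtain x where x: "x \<ge> 1" "- of_real M * z / D = complex_of_real x"
      by (auto simp: slit_plane_def D_def)
    then have eq: "- of_real M * z = of_real x * D"
      using D0 by (simp add: D_def field_simps)
    define u where "u = Re z"
    define v where "v = Im z"
    have re: "- M * u = x * (A * E - (A * F + B * E) * u + B * F * (u\<^sup>2 - v\<^sup>2))"
      using arg_cong[OF eq, of Re]
      by (simp add: D_def u_def v_def algebra_simps power2_eq_square)
    have im: "- M * v = x * (- (A * F + B * E) * v + 2 * B * F * u * v)"
      using arg_cong[OF eq, of Im]
      by (simp add: D_def u_def v_def algebra_simps power2_eq_square)
    \<comment> \<open>Multiply \<open>re\<close> by \<open>v\<close> and \<open>im\<close> by
      \<open>u\<close> and subtract: \<open>M\<close> and the linear terms of the denominator drop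
      out. The last factor is positive in the closed disc.\<close>
    have "x * v * (A * E - B * F * (u\<^sup>2 + v\<^sup>2)) = 0"
      using re im by algebra
    moreover have AE: "B * F < A * E"
      using B F by (intro mult_strict_mono') auto
    moreover have uv: "u\<^sup>2 + v\<^sup>2 \<le> 1"
      using z by (simp add: u_def v_def cmod_def)
    then have "B * F * (u\<^sup>2 + v\<^sup>2) \<le> B * F"
      using B F by (simp add: mult_left_le)
    ultimately have v0: "v = 0" using x(1) by auto
    have fac: "- M * u = x * ((A - B * u) * (E - F * u))"
      using re by (simp add: v0 algebra_simps power2_eq_square)
    have u1: "\<bar>u\<bar> \<le> 1" using uv v0 by (simp add: abs_square_le_1)
    have pos: "0 < (A - B * u) * (E - F * u)"
    proof (rule mult_pos_pos)
      have "B * u \<le> B * 1" "F * u \<le> F * 1"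
        using u1 B F by (intro mult_left_mono; simp)+
      then show "0 < A - B * u" "0 < E - F * u" using B F by auto
    qed
    have "u < 0"
    proof (rule ccontr)
      assume "\<not> u < 0"
      then have "- M * u \<le> 0" using M by (simp add: mult_nonneg_nonneg)
      moreover have "0 < x * ((A - B * u) * (E - F * u))" 
        by (rule mult_pos_pos) (use pos x(1) in linarith)+
      ultimately show False using fac by simp
    qed
    \<comment> \<open>The bound for the quotient at \<open>u\<close>, relative to its value at -1,
      amounts to nonnegativity of this difference, which vanishes at \<open>u = -1\<close>.\<close>
    have "(A - B * u) * (E - F * u) - (- u) * ((A + B) * (E + F)) = (1 + u) * (A * E + B * F * u)"
      by (simp add: algebra_simps)
    moreover have "0 \<le> (1 + u) * (A * E + B * F * u)"
    proof (rule mult_nonneg_nonneg)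
      have "B * F * (- u) \<le> B * F" using u1 B F by (intro mult_left_le) auto
      then show "0 \<le> A * E + B * F * u" using AE by simp
    qed (use u1 in auto)
    moreover have "(- u) * M < (- u) * ((A + B) * (E + F))"
      using M(2) \<open>u < 0\<close> by (intro mult_strict_left_mono) auto
    moreover have "1 * ((A - B * u) * (E - F * u)) \<le> x * ((A - B * u) * (E - F * u))"
      using x(1) pos by (intro mult_right_mono) auto
    ultimately show False using fac by (simp add: mult.commute)
  qed
qed

section \<open>The disc coordinate for a given slit\<close>

locale cut_data =
  fixes a b :: real
  assumes ab: "0 < a" "a < b" "b < 1"
begin

text \<open>With \<open>a^2 = T\<close> and \<open>b^2 = S\<close>, the value of the integral is
  \<open>pi / (r * p)\<close>.\<close>

definition r :: real where "r = sqrt (1 - a\<^sup>2)"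
definition p :: real where "p = sqrt (1 - b\<^sup>2)"
definition root_prod :: "real \<Rightarrow> real" where "root_prod z = sqrt (z - a\<^sup>2) * sqrt (b\<^sup>2 - z)"

lemma sq_less: "0 < a\<^sup>2" "a\<^sup>2 < b\<^sup>2" "b\<^sup>2 < 1"
  using ab by (auto simp: power_strict_mono abs_square_less_1)

lemma r2: "r\<^sup>2 = 1 - a\<^sup>2" and p2: "p\<^sup>2 = 1 - b\<^sup>2" and rp: "0 < p" "p < r"
  using sq_less by (auto simp: r_def p_def)

lemma root_prod_squared: "a\<^sup>2 \<le> z \<Longrightarrow> z \<le> b\<^sup>2 \<Longrightarrow> (root_prod z)\<^sup>2 = (z - a\<^sup>2) * (b\<^sup>2 - z)"
  by (simp add: root_prod_def power_mult_distrib)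

definition circle_den :: "complex \<Rightarrow> complex" where
  "circle_den \<zeta> = (of_real (r + p) - of_real (r - p) * \<zeta>) * (of_real (b * r + a * p) - of_real (b * r - a * p) * \<zeta>)"

text \<open>The rational function of the introduction. In a suitable coordinate \<open>\<zeta>\<close> of the unit disc, the points
  \<open>z = \<infinity>\<close> and \<open>z = 0\<close> lie at \<open>(r - p) / (r + p)\<close> and \<open>(b r - a p) / (b r + a p)\<close>; the poles are their reflections
  in the circle.\<close>

definition circle_arg :: "complex \<Rightarrow> complex" where
  "circle_arg \<zeta> = - of_real (2 * (1 + a) * (1 + b) * (b - a)) * \<zeta> / circle_den \<zeta>"

lemma ap_less_br: "a * p < b * r"
  using ab rp by (intro mult_strict_mono') auto

text \<open>Here \<open>A + B = 2 * r\<close> and \<open>E + F = 2 * b * r\<close>, so the required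
  bound on \<open>M\<close> reduces to \<open>(1 + b) * (b - a) < 2 * b * (1 - a)\<close>; the
  difference of the two sides is \<open>(a + b) * (1 - b)\<close>.\<close>

lemma
  assumes "norm \<zeta> \<le> 1"
  shows circle_den_nonzero: "circle_den \<zeta> \<noteq> 0" and circle_arg_in_slit_plane: "circle_arg \<zeta> \<in> slit_plane"
proof -
  have "0 < (a + b) * (1 - b)" using ab by simp
  then have "(1 + a) * ((1 + b) * (b - a)) < (1 + a) * (2 * b * (1 - a))"
    using ab by (intro mult_strict_left_mono) (auto simp: algebra_simps)
  moreover have "(r + p + (r - p)) * (b * r + a * p + (b * r - a * p)) = 2 * ((1 + a) * (2 * b * (1 - a)))"
  proof -
    have "(r + p + (r - p)) * (b * r + a * p + (b * r - a * p)) = 4 * b * r\<^sup>2"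
      by (simp add: power2_eq_square)
    then show ?thesis unfolding r2 by (simp add: algebra_simps power2_eq_square)
  qed
  ultimately have M: "2 * (1 + a) * (1 + b) * (b - a) < (r + p + (r - p)) * (b * r + a * p + (b * r - a * p))"
    by linarith
  have B: "0 \<le> r - p" "r - p < r + p" "0 \<le> b * r - a * p" "b * r - a * p < b * r + a * p"
      "0 \<le> 2 * (1 + a) * (1 + b) * (b - a)"
    using ab rp ap_less_br by auto
  show "circle_den \<zeta> \<noteq> 0" "circle_arg \<zeta> \<in> slit_plane"
    unfolding circle_arg_def circle_den_def
    using quotient_in_slit_plane[OF B(1,2,3,4,5) M assms] by auto
qed

lemma circle_arg_holomorphic: "circle_arg holomorphic_on cball 0 1"
  unfolding circle_arg_def using circle_den_nonzero
  by (auto intro!: holomorphic_intros simp: circle_den_def)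

lemma circle_arg_cnj: "circle_arg (cnj \<zeta>) = cnj (circle_arg \<zeta>)"
  by (simp add: circle_arg_def circle_den_def)

text \<open>The point \<open>z\<close> of the slit corresponds to the two points of the circle with real part
  \<open>circle_cos z\<close> and imaginary part \<open>\<plusminus> circle_sin z\<close>.\<close>

definition circle_cos :: "real \<Rightarrow> real" where
  "circle_cos z = (a\<^sup>2 + b\<^sup>2 - 2 * a\<^sup>2 * b\<^sup>2 - (2 - a\<^sup>2 - b\<^sup>2) * z) / ((b\<^sup>2 - a\<^sup>2) * (1 - z))"

definition circle_sin :: "real \<Rightarrow> real" where
  "circle_sin z = 2 * (p * r) * root_prod z / ((b\<^sup>2 - a\<^sup>2) * (1 - z))"

lemma circle_cos_sin:
  assumes "a\<^sup>2 \<le> z" "z \<le> b\<^sup>2"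
  shows "(circle_cos z)\<^sup>2 + (circle_sin z)\<^sup>2 = 1"
proof -
  have d: "(b\<^sup>2 - a\<^sup>2) * (1 - z) \<noteq> 0" using sq_less assms by auto
  have "(2 * (p * r) * root_prod z)\<^sup>2 = 4 * (1 - b\<^sup>2) * (1 - a\<^sup>2) * ((z - a\<^sup>2) * (b\<^sup>2 - z))"
    using root_prod_squared[OF assms] r2 p2 by (simp add: power_mult_distrib)
  moreover have "(a\<^sup>2 + b\<^sup>2 - 2 * a\<^sup>2 * b\<^sup>2 - (2 - a\<^sup>2 - b\<^sup>2) * z)\<^sup>2 +
     4 * (1 - b\<^sup>2) * (1 - a\<^sup>2) * ((z - a\<^sup>2) * (b\<^sup>2 - z)) = ((b\<^sup>2 - a\<^sup>2) * (1 - z))\<^sup>2"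
    by algebra
  ultimately show ?thesis
    using d by (simp add: circle_cos_def circle_sin_def power_divide add_divide_distrib[symmetric])
qed

lemma circle_sin_nonneg: "a\<^sup>2 \<le> z \<Longrightarrow> z \<le> b\<^sup>2 \<Longrightarrow> 0 \<le> circle_sin z"
  using sq_less rp by (auto simp: circle_sin_def root_prod_def intro!: divide_nonneg_nonneg mult_nonneg_nonneg)

lemma circle_sin_pos: "a\<^sup>2 < z \<Longrightarrow> z < b\<^sup>2 \<Longrightarrow> 0 < circle_sin z"
  using sq_less rp by (auto simp: circle_sin_def root_prod_def intro!: divide_pos_pos mult_pos_pos)

lemma circle_cos_bounds:
  assumes "a\<^sup>2 \<le> z" "z \<le> b\<^sup>2"
  shows "-1 \<le> circle_cos z" "circle_cos z \<le> 1"
proof -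
  have "(circle_cos z)\<^sup>2 \<le> 1" using circle_cos_sin[OF assms] zero_le_power2[of "circle_sin z"] by linarith
  then show "-1 \<le> circle_cos z" "circle_cos z \<le> 1" by (auto simp: abs_square_le_1)
qed

lemma cis_arccos_circle_cos:
  assumes "a\<^sup>2 \<le> z" "z \<le> b\<^sup>2"
  shows "cis (arccos (circle_cos z)) = Complex (circle_cos z) (circle_sin z)"
proof -
  have "sqrt (1 - (circle_cos z)\<^sup>2) = circle_sin z"
    using circle_cos_sin[OF assms] circle_sin_nonneg[OF assms] by (intro real_sqrt_unique) auto
  then show ?thesis
    using circle_cos_bounds[OF assms] by (simp add: complex_eq_iff sin_arccos)
qed

text \<open>\<open>circle_cos\<close> is a Moebius function of \<open>z\<close>. Dividing its
  derivative by \<open>- circle_sin z\<close> cancels one factor \<open>p * r\<close> and one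
  \<open>1 - z\<close>, which leaves the weight of the integral times \<open>p * r\<close>.\<close>

lemma arccos_circle_cos_deriv:
  assumes "a\<^sup>2 < z" "z < b\<^sup>2"
  shows "((\<lambda>z. arccos (circle_cos z)) has_field_derivative p * r / ((1 - z) * root_prod z)) (at z)"
proof -
  have z1: "1 - z > 0" and d: "b\<^sup>2 - a\<^sup>2 > 0" using sq_less assms by auto
  have mp: "root_prod z > 0" using assms by (simp add: root_prod_def)
  have cs: "(circle_cos z)\<^sup>2 + (circle_sin z)\<^sup>2 = 1" and sp: "circle_sin z > 0"
    using circle_cos_sin circle_sin_pos assms by auto
  then have c1: "(circle_cos z)\<^sup>2 < 1" by (smt (verit) zero_less_power)
  then have c2: "-1 < circle_cos z" "circle_cos z < 1" by (auto simp: abs_square_less_1)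
  have sq: "sqrt (1 - (circle_cos z)\<^sup>2) = circle_sin z"
    using cs sp by (intro real_sqrt_unique) auto
  have "(circle_cos has_field_derivative - (2 * (p * r)\<^sup>2) / ((b\<^sup>2 - a\<^sup>2) * (1 - z)\<^sup>2)) (at z)"
  proof -
    let ?k0 = "a\<^sup>2 + b\<^sup>2 - 2 * a\<^sup>2 * b\<^sup>2" and ?k1 = "2 - a\<^sup>2 - b\<^sup>2"
    have "(circle_cos has_field_derivative
       ((- ?k1) * ((b\<^sup>2 - a\<^sup>2) * (1 - z)) - (?k0 - ?k1 * z) * (- (b\<^sup>2 - a\<^sup>2))) /
         (((b\<^sup>2 - a\<^sup>2) * (1 - z)) * ((b\<^sup>2 - a\<^sup>2) * (1 - z)))) (at z)"
      unfolding circle_cos_def[abs_def]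
      by (rule derivative_eq_intros refl)+ (use z1 d in auto)
    \<comment> \<open>The terms in \<open>z\<close> cancel, leaving \<open>?k0 - ?k1\<close>, which
      equals \<open>- 2 * (p * r)\<^sup>2\<close>, times
      \<open>b\<^sup>2 - a\<^sup>2\<close>.\<close>
    also have "(- ?k1) * ((b\<^sup>2 - a\<^sup>2) * (1 - z)) - (?k0 - ?k1 * z) * (- (b\<^sup>2 - a\<^sup>2)) =
        - (2 * (p * r)\<^sup>2) * (b\<^sup>2 - a\<^sup>2)"
      by (simp add: power_mult_distrib p2 r2) (simp add: algebra_simps)
    also have "- (2 * (p * r)\<^sup>2) * (b\<^sup>2 - a\<^sup>2) / (((b\<^sup>2 - a\<^sup>2) * (1 - z)) * ((b\<^sup>2 - a\<^sup>2) * (1 - z))) =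
        - (2 * (p * r)\<^sup>2) / ((b\<^sup>2 - a\<^sup>2) * (1 - z)\<^sup>2)"
    proof -
      have "k * e / ((e * w) * (e * w)) = k / (e * w\<^sup>2)" if "e > 0" for e k w :: real
        using that by (simp add: power2_eq_square)
      then show ?thesis using d by blast
    qed
    finally show ?thesis .
  qed
  from DERIV_chain2[OF DERIV_arccos[OF c2] this]
  have "((\<lambda>z. arccos (circle_cos z)) has_field_derivative
      inverse (- circle_sin z) * (- (2 * (p * r)\<^sup>2) / ((b\<^sup>2 - a\<^sup>2) * (1 - z)\<^sup>2))) (at z)"
    by (simp add: sq)
  moreover have "inverse (- circle_sin z) * (- (2 * (p * r)\<^sup>2) / ((b\<^sup>2 - a\<^sup>2) * (1 - z)\<^sup>2)) =
      p * r / ((1 - z) * root_prod z)"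
  proof -
    have *: "inverse (- (2 * q * n / (e * w))) * (- (2 * q\<^sup>2) / (e * w\<^sup>2)) = q / (w * n)"
      if "e > 0" "w > 0" "n > 0" "q > 0" for e w n q :: real
      using that by (simp add: field_simps power2_eq_square)
    show ?thesis
      unfolding circle_sin_def by (rule *) (use z1 d mp rp in \<open>auto intro: mult_pos_pos\<close>)
  qed
  ultimately show ?thesis by simp
qed

text \<open>On the circle \<open>1 / \<zeta>\<close> is \<open>cnj \<zeta>\<close>, so dividing
  \<open>circle_den \<zeta>\<close> by \<open>\<zeta>\<close> gives a real-linear expression in
  \<open>\<zeta>\<close> and its conjugate, whose real and imaginary parts are explicit in
  \<open>z\<close>.\<close>

lemma circle_arg_boundary:
  assumes z: "a\<^sup>2 \<le> z" "z \<le> b\<^sup>2"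
  shows "circle_arg (Complex (circle_cos z) (circle_sin z)) =
    of_real ((1 - z) / (2 * (1 - a) * (1 - b) * z)) * Complex (z - a * b) (- root_prod z)"
proof -
  define \<zeta> where "\<zeta> = Complex (circle_cos z) (circle_sin z)"
  \<comment> \<open>The explicit form of \<open>circle_den \<zeta> / \<zeta>\<close>, confirmed
    below by comparing real and imaginary parts.\<close>
  define N where "N = of_real (- 4 * (1 - a\<^sup>2) * (1 - b\<^sup>2) / ((b - a) * (1 - z))) * Complex (z - a * b) (root_prod z)"
  have z0: "0 < z" "z < 1" using z sq_less by linarith+
  have d: "(b\<^sup>2 - a\<^sup>2) * (1 - z) \<noteq> 0" using sq_less z by auto
  have d': "(b - a) * (1 - z) \<noteq> 0" using ab z0 by auto
  have zz: "\<zeta> * cnj \<zeta> = 1"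
    using circle_cos_sin[OF z] by (simp add: \<zeta>_def complex_mult_cnj)
  then have "\<zeta> \<noteq> 0" by auto
  have Nre: "2 * (a + b) * (1 - a * b) * circle_cos z - 2 * (b - a) * (1 + a * b) =
      - 4 * (1 - a\<^sup>2) * (1 - b\<^sup>2) / ((b - a) * (1 - z)) * (z - a * b)"
  proof -
    have "2 * (a + b) * (1 - a * b) * circle_cos z = 2 * (1 - a * b) * 
       (a\<^sup>2 + b\<^sup>2 - 2 * a\<^sup>2 * b\<^sup>2 - (2 - a\<^sup>2 - b\<^sup>2) * z) / ((b - a) * (1 - z))"
    proof -
      have "b\<^sup>2 - a\<^sup>2 = (a + b) * (b - a)" by algebra
      moreover have "2 * w * q * (n / (w * v * y)) = 2 * q * n / (v * y)" if "w \<noteq> 0" for w q n v y :: real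
        using that by simp
      moreover have "a + b \<noteq> 0" using ab by simp
      ultimately show ?thesis unfolding circle_cos_def by metis
    qed
    moreover have "2 * (1 - a * b) * (a\<^sup>2 + b\<^sup>2 - 2 * a\<^sup>2 * b\<^sup>2 - (2 - a\<^sup>2 - b\<^sup>2) * z)
        - 2 * (b - a) * (1 + a * b) * ((b - a) * (1 - z)) = - 4 * (1 - a\<^sup>2) * (1 - b\<^sup>2) * (z - a * b)"
      by algebra
    moreover have "x - k = R / d * w" if "x = P / d" "P - k * d = R * w" "d \<noteq> 0" for x k P R d w :: real
      using that by (simp add: divide_simps left_diff_distrib)
    ultimately show ?thesis using d' by blast
  qed
  have Nim: "2 * (p * r) * (a + b) * circle_sin z = 4 * (1 - a\<^sup>2) * (1 - b\<^sup>2) / ((b - a) * (1 - z)) * root_prod z"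
  proof -
    have e: "b\<^sup>2 - a\<^sup>2 = (a + b) * (b - a)" by algebra
    have "2 * (p * r) * (a + b) * circle_sin z = 4 * (p\<^sup>2 * r\<^sup>2) * (a + b) * root_prod z / ((b\<^sup>2 - a\<^sup>2) * (1 - z))"
      by (simp add: circle_sin_def power2_eq_square)
    also have "\<dots> = 4 * (p\<^sup>2 * r\<^sup>2) * root_prod z / ((b - a) * (1 - z))"
      unfolding e using ab by simp
    finally show ?thesis by (simp add: r2 p2 mult_ac)
  qed
  have "N = of_real (2 * (a + b) * (1 - a * b) * circle_cos z - 2 * (b - a) * (1 + a * b)) - \<i> * of_real (2 * (p * r) * (a + b) * circle_sin z)"
  proof -
    have *: "of_real k * Complex x y = of_real (k * x) - \<i> * of_real (l * y)" if "k = - l" for k l x y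
      using that by (simp add: complex_eq_iff)
    show ?thesis
      unfolding Nre Nim N_def by (rule *) (simp only: mult_minus_left minus_divide_left)
  qed
  also have "\<dots> = of_real ((r + p) * (b * r + a * p)) * cnj \<zeta> + of_real ((r - p) * (b * r - a * p)) * \<zeta>
      - of_real ((r + p) * (b * r - a * p) + (r - p) * (b * r + a * p))"
  proof -
    have 1: "b * r\<^sup>2 + a * p\<^sup>2 = (a + b) * (1 - a * b)" "b * r\<^sup>2 - a * p\<^sup>2 = (b - a) * (1 + a * b)"
      unfolding r2 p2 by algebra+
    have "(r + p) * (b * r + a * p) + (r - p) * (b * r - a * p) = 2 * (b * r\<^sup>2 + a * p\<^sup>2)"
      "(r + p) * (b * r - a * p) + (r - p) * (b * r + a * p) = 2 * (b * r\<^sup>2 - a * p\<^sup>2)"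
      "(r + p) * (b * r + a * p) - (r - p) * (b * r - a * p) = 2 * (p * r) * (a + b)"
      by algebra+
    note 2 = this[unfolded 1]
    have 3: "of_real u * cnj \<zeta> + of_real v * \<zeta> - of_real w = of_real ((u + v) * circle_cos z - w) - \<i> * of_real ((u - v) * circle_sin z)" for u v w :: real
      by (simp add: complex_eq_iff \<zeta>_def algebra_simps)
    show ?thesis unfolding 3 2 by (simp only: mult.assoc)
  qed
  finally have N: "N = of_real ((r + p) * (b * r + a * p)) * cnj \<zeta> + of_real ((r - p) * (b * r - a * p)) * \<zeta>
      - of_real ((r + p) * (b * r - a * p) + (r - p) * (b * r + a * p))" .
  have *: "\<zeta> * (x * cnj \<zeta> + y * \<zeta> - w) = x * (\<zeta> * cnj \<zeta>) + y * \<zeta>\<^sup>2 - w * \<zeta>" for x y w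
    by (simp add: algebra_simps power2_eq_square)
  have den: "circle_den \<zeta> = \<zeta> * N"
    unfolding N * zz circle_den_def by (simp add: algebra_simps power2_eq_square)
  have nz: "norm \<zeta> \<le> 1"
    using circle_cos_sin[OF z] by (simp add: \<zeta>_def cmod_def)
  have N0: "N \<noteq> 0" using circle_den_nonzero[OF nz] den by auto
  have circle_arg: "circle_arg \<zeta> = - of_real (2 * (1 + a) * (1 + b) * (b - a)) / N"
    using \<open>\<zeta> \<noteq> 0\<close> by (simp add: circle_arg_def den)
  \<comment> \<open>Rationalizes \<open>1 / N\<close>: the squared modulus is free of the square
    roots, and the sign of \<open>root_prod z\<close> flips.\<close>
  have CC: "Complex (z - a * b) (root_prod z) * Complex (z - a * b) (- root_prod z) = of_real ((b - a)\<^sup>2 * z)"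
  proof -
    have "(z - a * b)\<^sup>2 + (root_prod z)\<^sup>2 = (b - a)\<^sup>2 * z"
      unfolding root_prod_squared[OF z] by algebra
    then show ?thesis by (simp add: complex_eq_iff power2_eq_square algebra_simps)
  qed
  have "(of_real k * P) * (of_real l * Q) = of_real (k * l * w)" if "Q * P = of_real w"
    for k l w :: real and P Q :: complex
  proof -
    have "(of_real k * P) * (of_real l * Q) = of_real k * of_real l * (Q * P)" by (simp add: mult_ac)
    then show ?thesis unfolding that by simp
  qed
  from this[OF CC] have "of_real ((1 - z) / (2 * (1 - a) * (1 - b) * z)) * Complex (z - a * b) (- root_prod z) * N =
     of_real ((1 - z) / (2 * (1 - a) * (1 - b) * z) * (- 4 * (1 - a\<^sup>2) * (1 - b\<^sup>2) / ((b - a) * (1 - z))) * ((b - a)\<^sup>2 * z))"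
    unfolding N_def .
  also have "(1 - z) / (2 * (1 - a) * (1 - b) * z) * (- 4 * (1 - a\<^sup>2) * (1 - b\<^sup>2) / ((b - a) * (1 - z))) * ((b - a)\<^sup>2 * z)
     = - (2 * (1 + a) * (1 + b) * (b - a))"
  proof -
    have "1 - a\<^sup>2 = (1 - a) * (1 + a)" "1 - b\<^sup>2 = (1 - b) * (1 + b)" by algebra+
    then show ?thesis using ab z0 d' by (simp add: divide_simps power2_eq_square) (simp add: algebra_simps)
  qed
  finally show ?thesis
    unfolding \<zeta>_def[symmetric] circle_arg using N0 by (simp add: field_simps)
qed

section \<open>From the product of the two factors to a conjugate pair of boundary values\<close>

text \<open>The formula \<open>2 cos x cos y = cos (x - y) + cos (x + y)\<close> for
  \<open>x = 2 i t \<alpha>\<close> and \<open>y = 2 i t (i \<phi>)\<close>. The doubled parameter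
  of the first factor compensates its half angle \<open>\<alpha> / 2\<close>. All four angles lie in
  the strip because \<open>0 < \<alpha> < pi\<close> and \<open>i \<phi>\<close> is
  imaginary.\<close>

lemma hyp2f1_product:
  assumes z: "a\<^sup>2 < z" "z < b\<^sup>2"
  shows "2 * (hyp2f1 (2 * \<i> * t) (- (2 * \<i> * t)) (1/2)
              (of_real ((1 + sqrt z) * (sqrt z - a) / (2 * (1 - a) * sqrt z)))
          * hyp2f1 (\<i> * t) (- (\<i> * t)) (1/2)
              (of_real (- ((b\<^sup>2 - z) * (1 - z) / ((1 - b)\<^sup>2 * z)))))
       = hyp2f1 (2 * \<i> * t) (- (2 * \<i> * t)) (1/2) (circle_arg (cis (arccos (circle_cos z))))
       + hyp2f1 (2 * \<i> * t) (- (2 * \<i> * t)) (1/2) (circle_arg (cnj (cis (arccos (circle_cos z)))))"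
proof -
  have z0: "0 < z" "z < 1" using z sq_less by linarith+
  define u where "u = sqrt z"
  have u: "0 < u" "u\<^sup>2 = z" "a < u" "u < b"
    using z z0 ab unfolding u_def by (auto intro: real_less_rsqrt real_less_lsqrt)
  define C where "C = (a - z) / ((1 - a) * u)"
  define H where "H = (b - z) / ((1 - b) * u)"
  \<comment> \<open>The values of \<open>sin \<alpha>\<close> and \<open>sinh \<phi>\<close>:
    \<open>(1 - a)^2 z - (a - z)^2\<close> factors as \<open>(z - a^2) (1 - z)\<close>, and
    \<open>(b - z)^2 - (1 - b)^2 z\<close> as \<open>(b^2 - z) (1 - z)\<close>.\<close>
  define sC where "sC = sqrt (z - a\<^sup>2) * sqrt (1 - z) / ((1 - a) * u)"
  define sH where "sH = sqrt (b\<^sup>2 - z) * sqrt (1 - z) / ((1 - b) * u)"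
  have C2: "C\<^sup>2 + sC\<^sup>2 = 1"
  proof -
    have "(a - z)\<^sup>2 + (z - a\<^sup>2) * (1 - z) = (1 - a)\<^sup>2 * z" by algebra
    then show ?thesis using z z0 ab u
      by (simp add: C_def sC_def power_divide power_mult_distrib add_divide_distrib[symmetric])
  qed
  have H2: "H\<^sup>2 = 1 + sH\<^sup>2"
  proof -
    have "(b - z)\<^sup>2 = (1 - b)\<^sup>2 * z + (b\<^sup>2 - z) * (1 - z)" by algebra
    then show ?thesis using z z0 ab u
      by (simp add: H_def sH_def power_divide power_mult_distrib add_divide_distrib)
  qed
  have sC: "0 < sC" and sH: "0 < sH"
    using z z0 ab u by (auto simp: sC_def sH_def)
  then have "C\<^sup>2 < 1" using C2 by (smt (verit) zero_less_power)
  then have C1: "-1 < C" "C < 1" by (auto simp: abs_square_less_1)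
  define \<alpha> where "\<alpha> = arccos C"
  \<comment> \<open>Taking \<open>\<phi>\<close> from its hyperbolic sine fixes its sign;
    \<open>cosh \<phi> = H\<close> then follows from equal squares and \<open>0 < H\<close>.\<close>
  define \<phi> where "\<phi> = arsinh sH"
  have \<alpha>: "cos \<alpha> = C" "0 < \<alpha>" "\<alpha> < pi"
    using C1 arccos_lt_bounded by (auto simp: \<alpha>_def)
  have sin\<alpha>: "sin \<alpha> = sC"
  proof -
    have "sqrt (1 - C\<^sup>2) = sC" using C2 sC by (intro real_sqrt_unique) auto
    then show ?thesis using C1 by (simp add: \<alpha>_def sin_arccos)
  qed
  have sinh\<phi>: "sinh \<phi> = sH" by (simp add: \<phi>_def)
  have "b\<^sup>2 < b" using ab by (simp add: power2_eq_square)
  then have "0 < H" using z ab u by (simp add: H_def)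
  moreover have "(cosh \<phi>)\<^sup>2 = H\<^sup>2" using cosh_square_eq[of \<phi>] H2 sinh\<phi> by simp
  ultimately have cosh\<phi>: "cosh \<phi> = H"
    using cosh_real_pos[of \<phi>] by (simp add: power2_eq_iff)
  have cosd: "cos (of_real \<alpha> - \<i> * of_real \<phi>) = Complex (C * H) (sC * sH)"
    by (simp add: complex_eq_iff Re_cos Im_cos \<alpha> sin\<alpha> flip: cosh\<phi> sinh\<phi>)
       (simp add: cosh_def sinh_def field_simps)
  have Xval: "circle_arg (cis (arccos (circle_cos z))) = sin ((of_real \<alpha> - \<i> * of_real \<phi>) / 2) ^ 2"
  proof -
    have "circle_arg (cis (arccos (circle_cos z))) = of_real ((1 - z) / (2 * (1 - a) * (1 - b) * z)) * Complex (z - a * b) (- root_prod z)"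
      using circle_arg_boundary[of z] cis_arccos_circle_cos[of z] z by simp
    also have "\<dots> = (1 - Complex (C * H) (sC * sH)) / 2"
    proof -
      have CH: "C * H = (a - z) * (b - z) / ((1 - a) * (1 - b) * z)"
        using u by (simp add: C_def H_def flip: u(2)) (simp add: power2_eq_square mult_ac)
      have ss: "sC * sH = (1 - z) * root_prod z / ((1 - a) * (1 - b) * z)"
      proof -
        have "sqrt (1 - z) * sqrt (1 - z) = 1 - z" using z0 by simp
        then have "sqrt (z - a\<^sup>2) * sqrt (1 - z) * (sqrt (b\<^sup>2 - z) * sqrt (1 - z)) = (1 - z) * root_prod z"
          by (simp add: root_prod_def mult_ac)
        moreover have "((1 - a) * u) * ((1 - b) * u) = (1 - a) * (1 - b) * z"
          unfolding u(2)[symmetric] by (simp add: power2_eq_square)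
        ultimately show ?thesis by (simp add: sC_def sH_def)
      qed
      have "(1 - C * H) / 2 = (1 - z) / (2 * (1 - a) * (1 - b) * z) * (z - a * b)"
        unfolding CH using z0 ab by (simp add: divide_simps) (simp add: algebra_simps)
      moreover have "sC * sH / 2 = (1 - z) / (2 * (1 - a) * (1 - b) * z) * root_prod z"
        unfolding ss by simp
      ultimately show ?thesis by (simp add: complex_eq_iff)
    qed
    also have "\<dots> = sin ((of_real \<alpha> - \<i> * of_real \<phi>) / 2) ^ 2"
    proof -
      have "1 - cos w = 2 * sin (w / 2) ^ 2" for w :: complex
        using cos_double_sin[of "w / 2"] by simp
      then show ?thesis unfolding cosd[symmetric] by simp
    qed
    finally show ?thesis .
  qed
  have "circle_arg (cnj (cis (arccos (circle_cos z)))) = cnj (sin ((of_real \<alpha> - \<i> * of_real \<phi>) / 2) ^ 2)"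
    unfolding circle_arg_cnj Xval ..
  also have "\<dots> = sin ((of_real \<alpha> + \<i> * of_real \<phi>) / 2) ^ 2"
    by (simp add: cnj_sin)
  finally have Xval': "circle_arg (cnj (cis (arccos (circle_cos z)))) = sin ((of_real \<alpha> + \<i> * of_real \<phi>) / 2) ^ 2" .
  have x1: "complex_of_real ((1 + sqrt z) * (sqrt z - a) / (2 * (1 - a) * sqrt z)) = sin (of_real \<alpha> / 2) ^ 2"
  proof -
    have "(1 + u) * (u - a) / (2 * (1 - a) * u) = (1 - C) / 2"
      using u ab by (simp add: C_def field_simps flip: u(2)) (simp add: algebra_simps power2_eq_square)
    also have "\<dots> = sin (\<alpha> / 2) ^ 2"
      using cos_double_sin[of "\<alpha> / 2"] by (simp flip: \<alpha>(1))
    finally show ?thesis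
      unfolding u_def by (metis of_real_power sin_of_real of_real_divide of_real_numeral)
  qed
  have x2: "complex_of_real (- ((b\<^sup>2 - z) * (1 - z) / ((1 - b)\<^sup>2 * z))) = sin (\<i> * of_real \<phi>) ^ 2"
  proof -
    have "(b\<^sup>2 - z) * (1 - z) / ((1 - b)\<^sup>2 * z) = sH\<^sup>2"
      using z z0 u by (simp add: sH_def power_divide power_mult_distrib)
    moreover have "sin (\<i> * of_real \<phi>) = \<i> * of_real (sinh \<phi>)"
      by (simp add: sin_i_times sinh_def scaleR_conv_of_real exp_of_real exp_minus)
    ultimately show ?thesis
      by (simp add: sinh\<phi> power_mult_distrib)
  qed
  have bd: "\<bar>Re (of_real \<alpha> / 2)\<bar> < pi / 2" "\<bar>Re (\<i> * of_real \<phi>)\<bar> < pi / 2"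
    "\<bar>Re ((of_real \<alpha> - \<i> * of_real \<phi>) / 2)\<bar> < pi / 2" "\<bar>Re ((of_real \<alpha> + \<i> * of_real \<phi>) / 2)\<bar> < pi / 2"
    using \<alpha> by auto
  have arg: "2 * (2 * \<i> * t) * ((x - y) / 2) = 2 * (2 * \<i> * t) * (x / 2) - 2 * (\<i> * t) * y"
    "2 * (2 * \<i> * t) * ((x + y) / 2) = 2 * (2 * \<i> * t) * (x / 2) + 2 * (\<i> * t) * y" for x y
    by (simp_all add: field_simps)
  show ?thesis
    unfolding Xval Xval' x1 x2 hyp2f1_sin_squared[OF bd(1)] hyp2f1_sin_squared[OF bd(2)]
      hyp2f1_sin_squared[OF bd(3)] hyp2f1_sin_squared[OF bd(4)] arg
    by (simp only: cos_diff cos_add) simp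
qed

end

section \<open>Change of variables to the half circle\<close>

theorem theorem1p1:
  fixes T S :: real and t :: complex
  assumes "0 < T" and "T < S" and "S < 1"
  shows "((\<lambda>z::real.
            hyp2f1 (2 * \<i> * t) (- 2 * \<i> * t) (1 / 2)
              (of_real ((1 + sqrt z) * (sqrt z - sqrt T) / (2 * (1 - sqrt T) * sqrt z)))
            * hyp2f1 (\<i> * t) (- \<i> * t) (1 / 2)
              (of_real (- ((S - z) * (1 - z) / ((1 - sqrt S)\<^sup>2 * z))))
            / of_real ((1 - z) * sqrt (z - T) * sqrt (S - z)))
          has_integral of_real (pi / (sqrt (1 - T) * sqrt (1 - S)))) {T..S}"
proof -
  define a where "a = sqrt T"
  define b where "b = sqrt S"
  have T: "T = a\<^sup>2" and S: "S = b\<^sup>2" using assms by (auto simp: a_def b_def)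
  interpret cut_data a b
    by standard (use assms in \<open>auto simp: a_def b_def\<close>)
  define K where "K = (\<lambda>\<zeta>. hyp2f1 (2 * \<i> * t) (- (2 * \<i> * t)) (1/2) (circle_arg \<zeta>))"
  define k where "k = (\<lambda>x. K (cis x) + K (cnj (cis x)))"
  have K: "K holomorphic_on cball 0 1"
    unfolding K_def
    by (rule holomorphic_on_compose_gen[OF circle_arg_holomorphic hyp2f1_holomorphic, unfolded o_def])
       (auto intro: circle_arg_in_slit_plane)
  \<comment> \<open>The dependence on \<open>t\<close> disappears here: at the centre the
    hypergeometric function is evaluated at 0.\<close>
  have "circle_arg 0 = 0" by (simp add: circle_arg_def)
  then have "K 0 = 1" by (simp add: K_def hyp2f1_at_0)
  then have kint: "(k has_integral 2 * of_real pi) {0..pi}"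
    unfolding k_def using mean_value_circle_symmetric[OF K] by simp
  have kcont: "continuous_on {0..pi} k"
    unfolding k_def
    by (intro continuous_intros continuous_on_compose2[OF holomorphic_on_imp_continuous_on[OF K]]) auto
  have circle_cos_ends: "circle_cos T = 1" "circle_cos S = -1"
    using assms by (auto simp: circle_cos_def divide_simps simp flip: T S) (auto simp: algebra_simps)
  \<comment> \<open>The substitution is the angle \<open>arccos (circle_cos z)\<close>, which runs
    from 0 to \<open>pi\<close>. Its derivative is singular at both ends of the slit, so these form
    the exceptional set.\<close>
  have "((\<lambda>z. (p * r / ((1 - z) * root_prod z)) *\<^sub>R k (arccos (circle_cos z))) has_integral
      integral {arccos (circle_cos T)..arccos (circle_cos S)} k) {T..S}"
  proof (rule has_integral_substitution_strong[where s = "{T, S}" and c = 0 and d = pi])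
    show "(\<lambda>z. arccos (circle_cos z)) ` {T..S} \<subseteq> {0..pi}"
      using circle_cos_bounds by (auto simp: T S intro!: arccos_lbound arccos_ubound)
    show "continuous_on {T..S} (\<lambda>z. arccos (circle_cos z))"
    proof (rule continuous_on_compose2[OF continuous_on_arccos'])
      show "continuous_on {T..S} circle_cos"
        unfolding circle_cos_def[abs_def] using assms sq_less by (intro continuous_intros) auto
    qed (use circle_cos_bounds in \<open>auto simp: T S\<close>)
    fix z assume "z \<in> {T..S} - {T, S}"
    then show "((\<lambda>z. arccos (circle_cos z)) has_real_derivative p * r / ((1 - z) * root_prod z)) (at z within {T..S})"
      using arccos_circle_cos_deriv[of z] by (auto simp: T S intro: DERIV_subset)
  qed (use assms kcont in \<open>auto simp: circle_cos_ends\<close>)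
  then have "((\<lambda>z. (p * r / ((1 - z) * root_prod z)) *\<^sub>R k (arccos (circle_cos z))) has_integral 2 * of_real pi) {T..S}"
    using kint by (simp add: circle_cos_ends integral_unique)
  \<comment> \<open>The factor \<open>p * r\<close> belongs to the derivative of the angle; the 2
    appears because \<open>k\<close> is twice the product of the hypergeometric factors.\<close>
  then have "((\<lambda>z. (p * r / ((1 - z) * root_prod z)) *\<^sub>R k (arccos (circle_cos z)) / of_real (2 * p * r)) has_integral
     2 * of_real pi / of_real (2 * p * r)) {T..S}"
    by (rule has_integral_divide)
  then have "((\<lambda>z. k (arccos (circle_cos z)) / 2 / of_real ((1 - z) * root_prod z)) has_integral of_real (pi / (r * p))) {T..S}"
    using rp by (simp add: scaleR_conv_of_real mult_ac divide_simps)
  then show ?thesis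
    unfolding r_def p_def T[symmetric] S[symmetric]
  \<comment> \<open>The product formula holds on the open interval; the two endpoints form a null
    set.\<close>
  proof (rule has_integral_spike_finite[where S = "{T, S}", rotated 2])
    fix z assume "z \<in> {T..S} - {T, S}"
    then have z: "a\<^sup>2 < z" "z < b\<^sup>2" by (auto simp: T S)
    show "hyp2f1 (2 * \<i> * t) (- 2 * \<i> * t) (1 / 2)
              (of_real ((1 + sqrt z) * (sqrt z - sqrt T) / (2 * (1 - sqrt T) * sqrt z)))
            * hyp2f1 (\<i> * t) (- \<i> * t) (1 / 2)
              (of_real (- ((S - z) * (1 - z) / ((1 - sqrt S)\<^sup>2 * z))))
            / of_real ((1 - z) * sqrt (z - T) * sqrt (S - z)) =
          k (arccos (circle_cos z)) / 2 / of_real ((1 - z) * root_prod z)"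
    proof -
      have minus: "- 2 * \<i> * t = - (2 * \<i> * t)" "- \<i> * t = - (\<i> * t)" by simp_all
      have half: "x = y / 2" if "2 * x = y" for x y :: complex
        using that by auto
      show ?thesis
        unfolding minus k_def K_def a_def[symmetric] b_def[symmetric] half[OF hyp2f1_product[OF z, of t, folded S]]
        by (simp only: root_prod_def mult.assoc T S)
    qed
  qed auto
qed

end
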